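(* Let $k \geq 2$ and $n,\alpha,\beta \geq 0$ be integers. Then $$C^k_{n,(\alpha,\beta)} = \left( \sum_{i \geq 0} (-1)^i \frac{\beta+1}{k(n-i)+\beta+1} \binom{k(n-i)+\beta+1}{n-i} \binom{\alpha-(k-1)i}{i} \right) - (-1)^n \binom{\alpha-\beta-1-(k-1)n}{n}.$$
   Context: For an integer $k\ge 2$ and integers $\alpha,\beta\ge 0$, $n \ge 0$, a raised $k$-Dyck path of shape $(\alpha,\beta)$ is an integer lattice path from $(0,\alpha)$ to $(kn+\beta-\alpha,\beta)$ using steps $U=(1,1)$ and $D=(1,1-k)$ that stays weakly above the line $y=0$; such a path has exactly $n$ steps $D$ and $n+\beta-\alpha$ steps $U$. Let $\mathcal{D}^k_{n,(\alpha,\beta)}$ be the set of these paths and $C^k_{n,(\alpha,\beta)} = |\mathcal{D}^k_{n,(\alpha,\beta)}|$ (the empty path counts when $n=0$, $\alpha=\beta$; the count is $0$ if $kn+\beta-\alpha<0$). Convention: $\binom{a}{b}=0$ whenever $a<0$ or $b<0$ (so all terms of the sum with $i>n$ vanish). *)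

theory Defs
  imports "HOL-Analysis.Analysis"
begin

datatype step = U | D

fun step_vec :: "nat \<Rightarrow> step \<Rightarrow> int \<times> int" where
  "step_vec k U = (1, 1)"
| "step_vec k D = (1, 1 - int k)"

definition path_end :: "nat \<Rightarrow> int \<times> int \<Rightarrow> step list \<Rightarrow> int \<times> int" where
  "path_end k p w = p + (\<Sum>s\<leftarrow>w. step_vec k s)"

(* A path is encoded by its start point together with its word of steps. Since it is piecewise
   linear between consecutive lattice points, it stays weakly above the line y = 0 iff all of its
   lattice points do; these are the ends of the prefixes of the word. *)
definition raised_dyck_paths :: "nat \<Rightarrow> nat \<Rightarrow> nat \<Rightarrow> nat \<Rightarrow> step list set" where
  "raised_dyck_paths k n \<alpha> \<beta> =
    {w. path_end k (0, int \<alpha>) w = (int k * int n + int \<beta> - int \<alpha>, int \<beta>) \<and>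
        (\<forall>j\<le>length w. snd (path_end k (0, int \<alpha>) (take j w)) \<ge> 0)}"

definition raised_dyck_number :: "nat \<Rightarrow> nat \<Rightarrow> nat \<Rightarrow> nat \<Rightarrow> nat" where
  "raised_dyck_number k n \<alpha> \<beta> = card (raised_dyck_paths k n \<alpha> \<beta>)"

(* Unlike gchoose, this vanishes whenever the upper argument is negative. *)
definition int_binomial :: "int \<Rightarrow> int \<Rightarrow> nat" where
  "int_binomial a b = (if a < 0 \<or> b < 0 then 0 else nat a choose nat b)"

lemma fst_path_end: "fst (path_end k p w) = fst p + int (length w)"
proof -
  have "fst (step_vec k s) = 1" for s by (cases s) auto
  then show ?thesis by (induction w arbitrary: p) (auto simp: path_end_def)
qed

lemma finite_raised_dyck_paths: "finite (raised_dyck_paths k n \<alpha> \<beta>)"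
proof (rule finite_subset)
  let ?N = "nat (int k * int n + int \<beta> - int \<alpha>)"
  show "raised_dyck_paths k n \<alpha> \<beta> \<subseteq> {w. set w \<subseteq> {U, D} \<and> length w = ?N}"
  proof
    fix w assume "w \<in> raised_dyck_paths k n \<alpha> \<beta>"
    then have "fst (path_end k (0, int \<alpha>) w) = int k * int n + int \<beta> - int \<alpha>"
      by (simp add: raised_dyck_paths_def)
    then have "length w = ?N" by (simp add: fst_path_end)
    moreover have "set w \<subseteq> {U, D}" using step.exhaust by blast
    ultimately show "w \<in> {w. set w \<subseteq> {U, D} \<and> length w = ?N}" by blast
  qed
  show "finite {w. set w \<subseteq> {U, D} \<and> length w = ?N}" by (rule finite_lists_length_eq) simp
qed

end

theory Submission
  imports Defs
begin

text \<open>
  Removing the first step of a path shows that the numbers \<open>C(n, \<alpha>)\<close> satisfy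
  \<open>C(n, \<alpha> + 1) = C(n, \<alpha>) - C(n - 1, \<alpha> + 1 - k) - [n = 0 \<and> \<alpha> = \<beta>]\<close>.
  Pascal's rule gives the same recursion for the right-hand side, whose last binomial coefficient
  accounts for the Iverson bracket, so it remains to treat \<open>\<alpha> = 0\<close>. There the sum reduces to the
  Raney number \<open>(\<beta> + 1) / (k n + \<beta> + 1) * binom (k n + \<beta> + 1) n\<close>, and one concludes by removing
  the last step of a path, which changes \<open>n\<close> and \<open>\<beta>\<close> but not \<open>\<alpha>\<close>.
\<close>

section \<open>Removing the first or the last step\<close>

lemma path_end_conv_count:
  "path_end k p w =
    (fst p + int (length w), snd p + int (length w) - int k * int (count_list w D))"
proof (induction w arbitrary: p)
  case Nil
  then show ?case by (simp add: path_end_def zero_prod_def)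
next
  case (Cons s w)
  have "path_end k p (s # w) = path_end k (p + step_vec k s) w"
    by (simp add: path_end_def add.assoc)
  then show ?case using Cons.IH[of "p + step_vec k s"]
    by (cases s) (auto simp: algebra_simps)
qed

lemma all_take_Cons:
  "(\<forall>j\<le>length (s # w). P (take j (s # w))) \<longleftrightarrow> P [] \<and> (\<forall>j\<le>length w. P (s # take j w))"
proof safe
  fix j assume *: "\<forall>j\<le>length (s # w). P (take j (s # w))"
  show "P []" using *[rule_format, of 0] by simp
  show "P (s # take j w)" if "j \<le> length w" using *[rule_format, of "Suc j"] that by simp
next
  fix j assume "P []" "\<forall>j\<le>length w. P (s # take j w)" "j \<le> length (s # w)"
  then show "P (take j (s # w))" by (cases j) auto
qed

lemma all_take_snoc:
  "(\<forall>j\<le>length (w @ [s]). P (take j (w @ [s]))) \<longleftrightarrow>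
    (\<forall>j\<le>length w. P (take j w)) \<and> P (w @ [s])"
proof -
  have "(\<forall>j\<le>length (w @ [s]). P (take j (w @ [s]))) \<longleftrightarrow>
    (\<forall>j\<le>length w. P (take j (w @ [s]))) \<and> P (w @ [s])"
    by (auto simp: le_Suc_eq)
  then show ?thesis by simp
qed

text \<open>The subtracted part of the height is moved to the left, so that the condition lives in
  the natural numbers without truncated subtraction.\<close>

definition stays_above :: "nat \<Rightarrow> nat \<Rightarrow> step list \<Rightarrow> bool" where
  "stays_above k \<alpha> w \<longleftrightarrow> (\<forall>j\<le>length w. k * count_list (take j w) D \<le> \<alpha> + length (take j w))"

lemma stays_above_Nil: "stays_above k \<alpha> []"
  by (simp add: stays_above_def)

lemma stays_above_U_Cons: "stays_above k \<alpha> (U # w) \<longleftrightarrow> stays_above k (Suc \<alpha>) w"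
  unfolding stays_above_def
    all_take_Cons[where P = "\<lambda>v. k * count_list v D \<le> \<alpha> + length v"] by simp

text \<open>After a first \<open>D\<close> the height is \<open>Suc \<alpha> - k\<close>; the guard
  is exactly the condition at that point and makes the subtraction exact.\<close>

lemma stays_above_D_Cons:
  "stays_above k \<alpha> (D # w) \<longleftrightarrow> k \<le> Suc \<alpha> \<and> stays_above k (Suc \<alpha> - k) w"
proof -
  have *: "stays_above k \<alpha> (D # w) \<longleftrightarrow>
    (\<forall>j\<le>length w. k + k * count_list (take j w) D \<le> Suc \<alpha> + length (take j w))"
    unfolding stays_above_def
      all_take_Cons[where P = "\<lambda>v. k * count_list v D \<le> \<alpha> + length v"] by simp
  show ?thesis
  proof (cases "k \<le> Suc \<alpha>")
    case True
    then obtain a where a: "Suc \<alpha> = k + a" by (metis le_Suc_ex)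
    show ?thesis unfolding * unfolding stays_above_def a by (simp add: add.assoc)
  next
    case False
    \<comment> \<open>The empty prefix of \<open>w\<close> stands for the point right after the
      first \<open>D\<close>.\<close>
    have "k + k * count_list (take 0 w) D \<le> Suc \<alpha> + length (take 0 w)" if "stays_above k \<alpha> (D # w)"
      using that unfolding * by blast
    with False show ?thesis by auto
  qed
qed

lemma stays_above_snoc:
  "stays_above k \<alpha> (w @ [s]) \<longleftrightarrow>
    stays_above k \<alpha> w \<and> k * count_list (w @ [s]) D \<le> \<alpha> + length (w @ [s])"
  unfolding stays_above_def
  by (rule all_take_snoc[where P = "\<lambda>v. k * count_list v D \<le> \<alpha> + length v"])

lemma stays_above_end: "stays_above k \<alpha> w \<Longrightarrow> k * count_list w D \<le> \<alpha> + length w"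
  unfolding stays_above_def by (metis order_refl take_all)

lemma mem_raised_dyck_paths_iff:
  assumes "k > 0"
  shows "w \<in> raised_dyck_paths k n \<alpha> \<beta> \<longleftrightarrow>
    count_list w D = n \<and> \<alpha> + length w = \<beta> + k * n \<and> stays_above k \<alpha> w"
proof -
  have le: "0 \<le> int \<alpha> + int a - int k * int c \<longleftrightarrow> k * c \<le> \<alpha> + a" for a c
    by (metis diff_ge_0_iff_ge of_nat_add of_nat_le_iff of_nat_mult)
  have ends: "int (length w) = int k * int n + int \<beta> - int \<alpha> \<and>
      int \<alpha> + int (length w) - int k * int (count_list w D) = int \<beta> \<longleftrightarrow>
      count_list w D = n \<and> \<alpha> + length w = \<beta> + k * n" (is "?L \<longleftrightarrow> ?R")
  proof
    assume ?L
    \<comment> \<open>The length equation turns the height equation into one about the number of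
      \<open>D\<close> steps alone, from which \<open>k > 0\<close> cancels.\<close>
    then have "int k * int (count_list w D) = int k * int n" by linarith
    with assms have "count_list w D = n" by simp
    moreover from \<open>?L\<close> have "int (\<alpha> + length w) = int (\<beta> + k * n)" by simp
    ultimately show ?R by (simp only: of_nat_eq_iff)
  next
    assume ?R
    then have "int (\<alpha> + length w) = int (\<beta> + k * n)" by simp
    with \<open>?R\<close> show ?L by simp
  qed
  show ?thesis
    unfolding raised_dyck_paths_def path_end_conv_count stays_above_def mem_Collect_eq
      fst_conv snd_conv prod.inject le conj_assoc[symmetric] ends[symmetric] add_0
    by simp
qed

lemma Nil_mem_raised_dyck_paths_iff:
  "k > 0 \<Longrightarrow> [] \<in> raised_dyck_paths k n \<alpha> \<beta> \<longleftrightarrow> n = 0 \<and> \<alpha> = \<beta>"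
  by (auto simp: mem_raised_dyck_paths_iff stays_above_Nil)

lemma U_Cons_mem_raised_dyck_paths_iff:
  "k > 0 \<Longrightarrow> U # w \<in> raised_dyck_paths k n \<alpha> \<beta> \<longleftrightarrow> w \<in> raised_dyck_paths k n (Suc \<alpha>) \<beta>"
  by (simp add: mem_raised_dyck_paths_iff stays_above_U_Cons)

lemma D_Cons_mem_raised_dyck_paths_iff:
  "k > 0 \<Longrightarrow> D # w \<in> raised_dyck_paths k n \<alpha> \<beta> \<longleftrightarrow>
    n > 0 \<and> k \<le> Suc \<alpha> \<and> w \<in> raised_dyck_paths k (n - 1) (Suc \<alpha> - k) \<beta>"
  by (cases n) (auto simp: mem_raised_dyck_paths_iff stays_above_D_Cons)

text \<open>Before a final \<open>U\<close> the height is \<open>\<beta> - 1\<close>, which must be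
  nonnegative. A final \<open>D\<close> descends from \<open>\<beta> + k - 1\<close>, never negative
  for \<open>k > 0\<close>, so only the case of \<open>U\<close> has a guard on
  \<open>\<beta>\<close>.\<close>

lemma snoc_U_mem_raised_dyck_paths_iff:
  "k > 0 \<Longrightarrow> w @ [U] \<in> raised_dyck_paths k n \<alpha> \<beta> \<longleftrightarrow>
    \<beta> > 0 \<and> w \<in> raised_dyck_paths k n \<alpha> (\<beta> - 1)"
  by (cases \<beta>) (auto simp: mem_raised_dyck_paths_iff stays_above_snoc dest: stays_above_end)

lemma snoc_D_mem_raised_dyck_paths_iff:
  "k > 0 \<Longrightarrow> w @ [D] \<in> raised_dyck_paths k n \<alpha> \<beta> \<longleftrightarrow>
    n > 0 \<and> w \<in> raised_dyck_paths k (n - 1) \<alpha> (\<beta> + k - 1)"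
  by (cases n) (auto simp: mem_raised_dyck_paths_iff stays_above_snoc)

text \<open>Empty words, words starting with \<open>U\<close> and words starting with
  \<open>D\<close> are disjoint classes. Solved for the term at \<open>Suc \<alpha>\<close>, this
  drives the induction on the starting height.\<close>

lemma raised_dyck_number_first_step:
  assumes "k > 0"
  shows "raised_dyck_number k n \<alpha> \<beta> = of_bool (n = 0 \<and> \<alpha> = \<beta>) + raised_dyck_number k n (Suc \<alpha>) \<beta>
    + (if n > 0 \<and> k \<le> Suc \<alpha> then raised_dyck_number k (n - 1) (Suc \<alpha> - k) \<beta> else 0)"
proof -
  let ?E = "if n = 0 \<and> \<alpha> = \<beta> then {[] :: step list} else {}"
  let ?U = "raised_dyck_paths k n (Suc \<alpha>) \<beta>"
  let ?D = "if n > 0 \<and> k \<le> Suc \<alpha> then raised_dyck_paths k (n - 1) (Suc \<alpha> - k) \<beta> else {}"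
  have fin: "finite ?E" "finite ?U" "finite ?D" by (auto intro: finite_raised_dyck_paths)
  have "w \<in> raised_dyck_paths k n \<alpha> \<beta> \<longleftrightarrow> w \<in> ?E \<union> Cons U ` ?U \<union> Cons D ` ?D" for w
  proof (cases w)
    case Nil
    then show ?thesis using Nil_mem_raised_dyck_paths_iff[OF assms] by auto
  next
    case (Cons s v)
    then show ?thesis
      using U_Cons_mem_raised_dyck_paths_iff[OF assms] D_Cons_mem_raised_dyck_paths_iff[OF assms]
      by (cases s) auto
  qed
  then have "raised_dyck_paths k n \<alpha> \<beta> = ?E \<union> Cons U ` ?U \<union> Cons D ` ?D" by blast
  moreover have "card (?E \<union> Cons U ` ?U \<union> Cons D ` ?D) = card (?E \<union> Cons U ` ?U) + card (Cons D ` ?D)"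
    using fin by (intro card_Un_disjoint) auto
  moreover have "card (?E \<union> Cons U ` ?U) = card ?E + card (Cons U ` ?U)"
    using fin by (intro card_Un_disjoint) auto
  ultimately show ?thesis by (simp add: raised_dyck_number_def card_image)
qed

lemma raised_dyck_number_last_step:
  assumes "k > 0"
  shows "raised_dyck_number k n \<alpha> \<beta> = of_bool (n = 0 \<and> \<alpha> = \<beta>)
    + (if \<beta> > 0 then raised_dyck_number k n \<alpha> (\<beta> - 1) else 0)
    + (if n > 0 then raised_dyck_number k (n - 1) \<alpha> (\<beta> + k - 1) else 0)"
proof -
  let ?E = "if n = 0 \<and> \<alpha> = \<beta> then {[] :: step list} else {}"
  let ?U = "if \<beta> > 0 then raised_dyck_paths k n \<alpha> (\<beta> - 1) else {}"
  let ?D = "if n > 0 then raised_dyck_paths k (n - 1) \<alpha> (\<beta> + k - 1) else {}"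
  let ?u = "\<lambda>w. w @ [U]" and ?d = "\<lambda>w. w @ [D]"
  have fin: "finite ?E" "finite ?U" "finite ?D" by (auto intro: finite_raised_dyck_paths)
  have "w \<in> raised_dyck_paths k n \<alpha> \<beta> \<longleftrightarrow> w \<in> ?E \<union> ?u ` ?U \<union> ?d ` ?D" for w
  proof (cases w rule: rev_cases)
    case Nil
    then show ?thesis using Nil_mem_raised_dyck_paths_iff[OF assms] by auto
  next
    case (snoc v s)
    then show ?thesis
      using snoc_U_mem_raised_dyck_paths_iff[OF assms] snoc_D_mem_raised_dyck_paths_iff[OF assms]
      by (cases s) auto
  qed
  then have "raised_dyck_paths k n \<alpha> \<beta> = ?E \<union> ?u ` ?U \<union> ?d ` ?D" by blast
  moreover have "card (?E \<union> ?u ` ?U \<union> ?d ` ?D) = card (?E \<union> ?u ` ?U) + card (?d ` ?D)"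
    using fin by (intro card_Un_disjoint) auto
  moreover have "card (?E \<union> ?u ` ?U) = card ?E + card (?u ` ?U)"
    using fin by (intro card_Un_disjoint) auto
  moreover have "inj_on ?u A" "inj_on ?d A" for A by (auto intro: inj_onI)
  ultimately show ?thesis by (simp add: raised_dyck_number_def card_image)
qed

section \<open>Paths starting at height zero\<close>

text \<open>The Raney (generalized Fuss-Catalan) numbers. For \<open>r = 0\<close> the value is 0,
  also at \<open>n = 0\<close>, where the quotient is 0 / 0.\<close>

definition raney :: "nat \<Rightarrow> nat \<Rightarrow> nat \<Rightarrow> real" where
  "raney k r n = real r / real (k * n + r) * real ((k * n + r) choose n)"

text \<open>Both binomials on the right have the upper entry \<open>M = k * n + r - 1\<close>. By
  absorption and Pascal's rule each is a rational multiple of \<open>b\<close>, which leaves an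
  identity between coefficients.\<close>

lemma raney_rec:
  assumes "k > 0" "n > 0" "r > 0"
  shows "raney k r n = raney k (r - 1) n + raney k (r + k - 1) (n - 1)"
proof -
  obtain m where n: "n = Suc m" using assms(2) gr0_conv_Suc by blast
  define M where "M = k * n + r - 1"
  have M: "k * n + r = Suc M" "k * n + (r - 1) = M" "k * (n - 1) + (r + k - 1) = M"
    using assms by (auto simp: M_def n)
  have "k * n \<ge> n" using assms by simp
  then have "M \<ge> n" using assms unfolding M_def by linarith
  define b where "b = real (Suc M choose n)"
  have lower: "real (M choose m) * real (Suc M) = real n * b"
    using Suc_times_binomial[of m M] unfolding b_def n by (metis mult.commute of_nat_mult)
  have "b = real (M choose n) + real (M choose m)" unfolding b_def n by simp
  with lower have upper: "real (M choose n) * real (Suc M) = (real (Suc M) - real n) * b"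
    by (simp add: algebra_simps)
  have r: "real (r - 1) = real r - 1" "real (r + k - 1) = real r + real k - 1"
    using assms by (auto simp: of_nat_diff)
  have "real (Suc M) = real k * real n + real r" using M(1) by (metis of_nat_add of_nat_mult)
  then have kn: "real k * real n = real M + 1 - real r" by simp
  have "real (Suc M) * (real (r - 1) * real (M choose n) + real (r + k - 1) * real (M choose m))
      = (real r - 1) * ((real (Suc M) - real n) * b) + (real r + real k - 1) * (real n * b)"
    unfolding upper[symmetric] lower[symmetric] r by (simp add: algebra_simps)
  also have "\<dots> = ((real r - 1) * real (Suc M) + real k * real n) * b"
    by (simp add: algebra_simps)
  \<comment> \<open>With \<open>k * n = M + 1 - r\<close> the coefficient becomes
    \<open>(r - 1) * (M + 1) + (M + 1 - r) = r * M\<close>.\<close>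
  also have "\<dots> = real r * real M * b" unfolding kn by (simp add: algebra_simps)
  finally have "real (Suc M) * (real (r - 1) * real (M choose n) + real (r + k - 1) * real (M choose m))
      = real r * real M * b" .
  moreover have "M > 0" using \<open>M \<ge> n\<close> assms by simp
  ultimately have "real r / real (Suc M) * b
      = real (r - 1) / real M * real (M choose n) + real (r + k - 1) / real M * real (M choose m)"
    by (simp add: field_simps)
  then show ?thesis unfolding raney_def M b_def by (simp add: n)
qed

text \<open>The last-step recursion is \<open>raney_rec\<close> with \<open>r = Suc \<beta>\<close>.
  The induction measure \<open>k * n + \<beta>\<close> is the length of the path, so either kind of
  last step lowers it by one.\<close>

lemma raised_dyck_number_from_0:
  assumes "k > 0"
  shows "real (raised_dyck_number k n 0 \<beta>) = raney k (Suc \<beta>) n"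
proof (induction "k * n + \<beta>" arbitrary: n \<beta> rule: less_induct)
  case less
  have up: "real (raised_dyck_number k n 0 (\<beta> - 1)) = raney k \<beta> n" if "\<beta> > 0"
    using less[of n "\<beta> - 1"] that by simp
  have down: "real (raised_dyck_number k (n - 1) 0 (\<beta> + k - 1)) = raney k (\<beta> + k) (n - 1)"
    if "n > 0"
    using less[of "n - 1" "\<beta> + k - 1"] that assms by (cases n) auto
  \<comment> \<open>The value at \<open>r = 0\<close> matches the missing \<open>U\<close> term for
    \<open>\<beta> = 0\<close>; the values at \<open>n = 0\<close> count the single path made of
    \<open>U\<close> steps.\<close>
  have 0: "raney k 0 n = 0" and n0: "raney k (Suc r) 0 = 1" for r by (simp_all add: raney_def)
  show ?case
  proof (cases "n = 0")
    case True
    then show ?thesis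
      using raised_dyck_number_last_step[OF assms, of n 0 \<beta>] up n0[of "\<beta> - 1"] n0[of \<beta>] by auto
  next
    case False
    then show ?thesis
      using raised_dyck_number_last_step[OF assms, of n 0 \<beta>] up down 0
        raney_rec[OF assms, of n "Suc \<beta>"] by (cases "\<beta> = 0") auto
  qed
qed

section \<open>The recursion for the alternating sum\<close>

lemma int_binomial_0_right: "int_binomial a 0 = of_bool (a \<ge> 0)"
  by (simp add: int_binomial_def)

lemma int_binomial_neg: "a < 0 \<Longrightarrow> int_binomial a b = 0"
  by (simp add: int_binomial_def)

text \<open>Pascal's rule survives the zero convention because the lower index is positive: at
  \<open>a = -1\<close> both sides are 0. For lower index 0 the value jumps from 0 to 1
  there.\<close>

lemma int_binomial_Suc:
  "int_binomial (a + 1) (int (Suc i)) = int_binomial a (int (Suc i)) + int_binomial a (int i)"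
proof (cases "a \<ge> 0")
  case True
  then have "nat (a + 1) = Suc (nat a)" by simp
  with True show ?thesis unfolding int_binomial_def nat_int by simp
next
  case False
  then have "a + 1 < 0 \<or> a + 1 = 0" by linarith
  with False show ?thesis unfolding int_binomial_def nat_int by auto
qed

text \<open>Here \<open>d\<close> stands for \<open>k - 1\<close> and \<open>c\<close> for the Raney
  numbers; the recursion holds for any coefficients \<open>c\<close>.\<close>

definition alt_sum :: "int \<Rightarrow> (nat \<Rightarrow> real) \<Rightarrow> nat \<Rightarrow> int \<Rightarrow> real" where
  "alt_sum d c n a = (\<Sum>i\<le>n. (-1) ^ i * c (n - i) * real (int_binomial (a - d * int i) (int i)))"

lemma alt_sum_neg:
  assumes "d \<ge> 0" "a < 0"
  shows "alt_sum d c n a = 0"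
proof -
  have "a - d * int i < 0" for i
    using assms mult_nonneg_nonneg[of d "int i"] by linarith
  then show ?thesis by (simp add: alt_sum_def int_binomial_neg)
qed

lemma alt_sum_at_0:
  assumes "d > 0"
  shows "alt_sum d c n 0 = c n"
proof -
  have "alt_sum d c n 0 = (\<Sum>i\<le>n. if i = 0 then c n else 0)"
    unfolding alt_sum_def
    by (intro sum.cong refl) (use assms in \<open>auto simp: int_binomial_neg int_binomial_0_right\<close>)
  then show ?thesis by simp
qed

text \<open>Pascal's rule splits each term with \<open>i > 0\<close>; reindexing the second halves
  gives the sum for \<open>n - 1\<close> at \<open>a - d\<close>, with the sign flipped. The term
  \<open>i = 0\<close> is unchanged because \<open>a \<ge> 0\<close>.\<close>

lemma alt_sum_rec:
  assumes "a \<ge> 0"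
  shows "alt_sum d c n (a + 1) = alt_sum d c n a - (if n > 0 then alt_sum d c (n - 1) (a - d) else 0)"
proof (cases n)
  case 0
  then show ?thesis using assms by (simp add: alt_sum_def int_binomial_0_right)
next
  case (Suc m)
  have pascal: "int_binomial (a + 1 - d * int (Suc i)) (int (Suc i)) =
      int_binomial (a - d * int (Suc i)) (int (Suc i)) + int_binomial (a - d - d * int i) (int i)" for i
    using int_binomial_Suc[of "a - d * int (Suc i)" i] by (simp add: algebra_simps)
  show ?thesis
    unfolding alt_sum_def Suc sum.atMost_Suc_shift pascal using assms
    by (simp add: int_binomial_0_right algebra_simps sum.distrib sum_subtractf sum_negf)
qed

definition shift_term :: "int \<Rightarrow> int \<Rightarrow> nat \<Rightarrow> int \<Rightarrow> real" where
  "shift_term d b n a = (-1) ^ n * real (int_binomial (a - b - 1 - d * int n) (int n))"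

lemma shift_term_eq_0:
  assumes "d \<ge> 0" "a \<le> b"
  shows "shift_term d b n a = 0"
proof -
  have "0 \<le> d * int n" using assms(1) by simp
  with assms(2) have "a - b - 1 - d * int n < 0" by linarith
  then show ?thesis by (simp add: shift_term_def int_binomial_neg)
qed

text \<open>For \<open>n = 0\<close> the term is the indicator of \<open>a > b\<close>, and its jump
  at \<open>a = b\<close> is the Iverson bracket. For \<open>n > 0\<close> this is Pascal's rule,
  valid for every \<open>a\<close>.\<close>

lemma shift_term_rec:
  "shift_term d b n (a + 1) = shift_term d b n a
    - (if n > 0 then shift_term d b (n - 1) (a - d) else 0) + of_bool (n = 0 \<and> a = b)"
proof (cases n)
  case 0
  then show ?thesis by (simp add: shift_term_def int_binomial_0_right)
next
  case (Suc m)
  then show ?thesis using int_binomial_Suc[of "a - b - 1 - d * int n" m]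
    by (simp add: shift_term_def algebra_simps)
qed

section \<open>The formula for arbitrary starting height\<close>

lemma raised_dyck_number_eq:
  assumes "k \<ge> 2"
  shows "real (raised_dyck_number k n \<alpha> \<beta>) =
    alt_sum (int k - 1) (raney k (Suc \<beta>)) n (int \<alpha>) - shift_term (int k - 1) (int \<beta>) n (int \<alpha>)"
proof (induction \<alpha> arbitrary: n rule: less_induct)
  case (less \<alpha>)
  let ?F = "\<lambda>n a. alt_sum (int k - 1) (raney k (Suc \<beta>)) n a - shift_term (int k - 1) (int \<beta>) n a"
  have k: "k > 0" using assms by simp
  show ?case
  proof (cases \<alpha>)
    case 0
    then show ?thesis
      using assms by (simp add: raised_dyck_number_from_0 alt_sum_at_0 shift_term_eq_0)
  next
    case (Suc a)
    have rec: "?F n (int \<alpha>) = ?F n (int a) - (if n > 0 then ?F (n - 1) (int a - (int k - 1)) else 0)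
        - of_bool (n = 0 \<and> a = \<beta>)"
      using alt_sum_rec[of "int a" "int k - 1" "raney k (Suc \<beta>)" n]
        shift_term_rec[of "int k - 1" "int \<beta>" n "int a"]
      by (simp add: Suc add.commute)
    \<comment> \<open>If \<open>k > Suc a\<close>, no path can start with \<open>D\<close>; on the
      other side \<open>a - (k - 1)\<close> is negative, so both parts of \<open>?F\<close>
      vanish.\<close>
    have "real (if n > 0 \<and> k \<le> Suc a then raised_dyck_number k (n - 1) (Suc a - k) \<beta> else 0)
      = (if n > 0 then ?F (n - 1) (int a - (int k - 1)) else 0)"
    proof (cases "k \<le> Suc a")
      case True
      then have diff: "int (Suc a - k) = int a - (int k - 1)" by simp
      have "Suc a - k < \<alpha>" using k Suc by simp
      from less[OF this, of "n - 1", unfolded diff] True show ?thesis by auto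
    next
      case False
      then show ?thesis using k by (simp add: alt_sum_neg shift_term_eq_0)
    qed
    moreover have "real (raised_dyck_number k n a \<beta>) = ?F n (int a)"
      using less[of a n] Suc by simp
    \<comment> \<open>The first-step recursion is applied at height \<open>a\<close>, so that the
      unknown value at \<open>\<alpha> = Suc a\<close> is its \<open>U\<close> term.\<close>
    moreover have "real (raised_dyck_number k n a \<beta>) =
      of_bool (n = 0 \<and> a = \<beta>) + real (raised_dyck_number k n \<alpha> \<beta>) +
      real (if n > 0 \<and> k \<le> Suc a then raised_dyck_number k (n - 1) (Suc a - k) \<beta> else 0)"
      unfolding Suc by (subst raised_dyck_number_first_step[OF k]) simp
    ultimately show ?thesis using rec by linarith
  qed
qed

theorem theorem2p3:
  fixes k n \<alpha> \<beta> :: nat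
  assumes "k \<ge> 2"
  shows "real (raised_dyck_number k n \<alpha> \<beta>) =
    (\<Sum>i. (-1) ^ i
          * (real (\<beta> + 1) / real_of_int (int k * (int n - int i) + int \<beta> + 1))
          * real (int_binomial (int k * (int n - int i) + int \<beta> + 1) (int n - int i))
          * real (int_binomial (int \<alpha> - (int k - 1) * int i) (int i)))
    - (-1) ^ n * real (int_binomial (int \<alpha> - int \<beta> - 1 - (int k - 1) * int n) (int n))"
proof -
  let ?t = "\<lambda>i. (-1) ^ i
          * (real (\<beta> + 1) / real_of_int (int k * (int n - int i) + int \<beta> + 1))
          * real (int_binomial (int k * (int n - int i) + int \<beta> + 1) (int n - int i))
          * real (int_binomial (int \<alpha> - (int k - 1) * int i) (int i))"
  \<comment> \<open>For \<open>i > n\<close> the lower entry \<open>n - i\<close> is negative, so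
    the series is a finite sum.\<close>
  have "(\<Sum>i. ?t i) = (\<Sum>i\<le>n. ?t i)"
    by (rule suminf_finite) (auto simp: int_binomial_def)
  also have "\<dots> = alt_sum (int k - 1) (raney k (Suc \<beta>)) n (int \<alpha>)"
    unfolding alt_sum_def
  proof (rule sum.cong)
    fix i assume "i \<in> {..n}"
    then have diff: "int n - int i = int (n - i)" by auto
    have top: "int k * int (n - i) + int \<beta> + 1 = int (k * (n - i) + Suc \<beta>)" by simp
    show "?t i = (-1) ^ i * raney k (Suc \<beta>) (n - i) *
        real (int_binomial (int \<alpha> - (int k - 1) * int i) (int i))"
      unfolding diff top raney_def
      by (simp only: int_binomial_def nat_int of_nat_less_0_iff of_int_of_nat_eq Suc_eq_plus1 if_False simp_thms mult.assoc)
  qed simp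
  finally show ?thesis using raised_dyck_number_eq[OF assms] by (simp add: shift_term_def)
qed

end
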